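(* Let $X$ be a compact topological space and $A\subseteq\mathcal C(X)$. Then the following are equivalent: (i) $A$ is an $\mathcal L(1)$-set. (ii) There is a metric $d$ on $X$ making $(X,d)$ (with the given topology) a topometric space such that $A=\mathcal C_{\mathcal L(1)}(X)$, the set of continuous $1$-Lipschitz functions $X\to\mathbb C$. In this case the metric $d$ is unique and is given by $d(x,y)=\sup_{f\in A}|f(x)-f(y)|$.
   Context: $\mathcal C(X)$ is the set of continuous functions $X\to\mathbb C$. A topometric space is a triple $(X,\mathcal T,d)$ where $\mathcal T$ is a topology and $d\colon X\times X\to[0,\infty]$ is a metric (possibly taking value $\infty$) such that $d$ is lower semi-continuous with respect to $\mathcal T\times\mathcal T$ and every $\mathcal T$-open set is open in the metric topology of $d$. A function $f$ is $1$-Lipschitz if $|f(x)-f(y)|\le d(x,y)$. A set $A\subseteq\mathcal C(X)$ is an $\mathcal L(1)$-set if: (1) $A$ is convex, closed under multiplication by scalars $\alpha\in\mathbb C$ with $|\alpha|\le1$, and closed under taking absolute value $f\mapsto|f|$; (2) $A$ separates points of $X$; (3) $A$ contains all constant functions; (4) if $f\notin A$ then there are $x,y\in X$ and $\varepsilon>0$ such that every $g\in\mathcal C(X)$ with $|f(x)-g(x)|<\varepsilon$ and $|f(y)-g(y)|<\varepsilon$ satisfies $g\notin A$. *)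

theory Defs
  imports "HOL-Analysis.Analysis"
begin

text \<open>A topological space is a value \<open>X :: 'a topology\<close> with carrier \<open>topspace X\<close>. Functions on it are
  represented by elements of \<open>extensional (topspace X)\<close>, so that equality of functions is
  equality on the carrier.\<close>

definition Cfun :: "'a topology \<Rightarrow> ('a \<Rightarrow> complex) set" where
  "Cfun X = {f \<in> extensional (topspace X). continuous_map X euclidean f}"

definition ext_metric_on :: "'a set \<Rightarrow> ('a \<Rightarrow> 'a \<Rightarrow> ennreal) \<Rightarrow> bool" where
  "ext_metric_on M d \<longleftrightarrow>
     (\<forall>x\<in>M. \<forall>y\<in>M. d x y = 0 \<longleftrightarrow> x = y) \<and>
     (\<forall>x\<in>M. \<forall>y\<in>M. d x y = d y x) \<and>
     (\<forall>x\<in>M. \<forall>y\<in>M. \<forall>z\<in>M. d x z \<le> d x y + d y z)"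

definition ext_metric_open :: "'a set \<Rightarrow> ('a \<Rightarrow> 'a \<Rightarrow> ennreal) \<Rightarrow> 'a set \<Rightarrow> bool" where
  "ext_metric_open M d U \<longleftrightarrow>
     U \<subseteq> M \<and> (\<forall>x\<in>U. \<exists>\<epsilon>>0. \<forall>y\<in>M. d x y < \<epsilon> \<longrightarrow> y \<in> U)"

definition lower_semicontinuous_map :: "'b topology \<Rightarrow> ('b \<Rightarrow> ennreal) \<Rightarrow> bool" where
  "lower_semicontinuous_map Y h \<longleftrightarrow> (\<forall>r. openin Y {p \<in> topspace Y. r < h p})"

definition topometric_space :: "'a topology \<Rightarrow> ('a \<Rightarrow> 'a \<Rightarrow> ennreal) \<Rightarrow> bool" where
  "topometric_space X d \<longleftrightarrow>
     ext_metric_on (topspace X) d \<and>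
     lower_semicontinuous_map (prod_topology X X) (\<lambda>(x, y). d x y) \<and>
     (\<forall>U. openin X U \<longrightarrow> ext_metric_open (topspace X) d U)"

definition one_Lipschitz_on :: "'a set \<Rightarrow> ('a \<Rightarrow> 'a \<Rightarrow> ennreal) \<Rightarrow> ('a \<Rightarrow> complex) \<Rightarrow> bool" where
  "one_Lipschitz_on M d f \<longleftrightarrow> (\<forall>x\<in>M. \<forall>y\<in>M. ennreal (cmod (f x - f y)) \<le> d x y)"

definition C_L1 :: "'a topology \<Rightarrow> ('a \<Rightarrow> 'a \<Rightarrow> ennreal) \<Rightarrow> ('a \<Rightarrow> complex) set" where
  "C_L1 X d = {f \<in> Cfun X. one_Lipschitz_on (topspace X) d f}"

definition L1_set :: "'a topology \<Rightarrow> ('a \<Rightarrow> complex) set \<Rightarrow> bool" where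
  "L1_set X A \<longleftrightarrow>
     A \<subseteq> Cfun X \<and>
     (\<forall>f\<in>A. \<forall>g\<in>A. \<forall>t::real. 0 \<le> t \<and> t \<le> 1 \<longrightarrow>
        (\<lambda>x\<in>topspace X. of_real (1 - t) * f x + of_real t * g x) \<in> A) \<and>
     (\<forall>f\<in>A. \<forall>\<alpha>::complex. cmod \<alpha> \<le> 1 \<longrightarrow> (\<lambda>x\<in>topspace X. \<alpha> * f x) \<in> A) \<and>
     (\<forall>f\<in>A. (\<lambda>x\<in>topspace X. complex_of_real (cmod (f x))) \<in> A) \<and>
     (\<forall>x\<in>topspace X. \<forall>y\<in>topspace X. x \<noteq> y \<longrightarrow> (\<exists>f\<in>A. f x \<noteq> f y)) \<and>
     (\<forall>c::complex. (\<lambda>x\<in>topspace X. c) \<in> A) \<and>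
     (\<forall>f\<in>Cfun X. f \<notin> A \<longrightarrow>
        (\<exists>x\<in>topspace X. \<exists>y\<in>topspace X. \<exists>\<epsilon>::real. \<epsilon> > 0 \<and>
           (\<forall>g\<in>Cfun X. cmod (f x - g x) < \<epsilon> \<and> cmod (f y - g y) < \<epsilon> \<longrightarrow> g \<notin> A)))"

end

theory Submission
  imports Defs
begin

text \<open>The substance of (ii) implies (i) and of uniqueness is the formula
  \<open>d x y = (SUP f\<in>C_L1 X d. \<bar>f x - f y\<bar>)\<close>, a Lipschitz version of Urysohn's lemma. By lower
  semicontinuity and compactness the closed \<open>r\<close>-neighbourhood of a closed set is closed, so normality
  interpolates open sets \<open>U p\<close>, indexed by a countable dense set of levels \<open>p\<close>, such that the closure
  of \<open>U p\<close> has distance more than \<open>q - p\<close> from the complement of \<open>U q\<close> whenever \<open>p < q\<close>; then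
  \<open>f x = Inf {p. x \<in> U p}\<close> is continuous and 1-Lipschitz. For (i) implies (ii) let \<open>d\<close> be the supremum
  over \<open>A\<close>: a 1-Lipschitz \<open>f\<close> is approximated at any two points by some \<open>\<beta> h + c\<close> with \<open>h \<in> A\<close> and
  \<open>\<bar>\<beta>\<bar> < 1\<close>, which lies in \<open>A\<close>, so the last axiom gives \<open>f \<in> A\<close>.\<close>

section \<open>Continuity and semicontinuity of sections\<close>

lemma continuous_map_euclidean_compose:
  assumes "continuous_map X euclidean f" "continuous_on UNIV h"
  shows "continuous_map X euclidean (\<lambda>x. h (f x))"
  using continuous_map_compose[OF assms(1), of euclidean h] assms(2) by (simp add: comp_def)

lemma openin_lower_semicontinuous_section:
  assumes "lower_semicontinuous_map (prod_topology X X) (\<lambda>(x, y). d x y)" "x \<in> topspace X"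
  shows "openin X {y \<in> topspace X. r < d x y}"
proof -
  have o: "openin (prod_topology X X) {p \<in> topspace (prod_topology X X). r < (case p of (x, y) \<Rightarrow> d x y)}"
    using assms(1) unfolding lower_semicontinuous_map_def by blast
  have c: "continuous_map X (prod_topology X X) (\<lambda>y. (x, y))"
    using assms(2) by (simp add: continuous_map_pairedI)
  have "{y \<in> topspace X. r < d x y} =
      {y \<in> topspace X. (x, y) \<in> {p \<in> topspace (prod_topology X X). r < (case p of (x, y) \<Rightarrow> d x y)}}"
    using assms(2) by auto
  then show ?thesis
    using openin_continuous_map_preimage[OF c o] by simp
qed

section \<open>Topology of a compact space with a lower semicontinuous metric\<close>

text \<open>Stated through the metric axioms and lower semicontinuity so that it can be interpreted
  for the supremum metric built from an L(1)-set, where the refinement condition is then derived by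
  compactness.\<close>

locale compact_topometric =
  fixes X :: "'a topology" and d :: "'a \<Rightarrow> 'a \<Rightarrow> ennreal"
  assumes compact: "compact_space X"
    and metric: "ext_metric_on (topspace X) d"
    and lsc: "lower_semicontinuous_map (prod_topology X X) (\<lambda>(x, y). d x y)"
begin

lemma dist_zero_iff: "x \<in> topspace X \<Longrightarrow> y \<in> topspace X \<Longrightarrow> d x y = 0 \<longleftrightarrow> x = y"
  and dist_commute: "x \<in> topspace X \<Longrightarrow> y \<in> topspace X \<Longrightarrow> d x y = d y x"
  and dist_triangle:
    "x \<in> topspace X \<Longrightarrow> y \<in> topspace X \<Longrightarrow> z \<in> topspace X \<Longrightarrow> d x z \<le> d x y + d y z"
  using metric unfolding ext_metric_on_def by blast+

lemma dist_self [simp]: "x \<in> topspace X \<Longrightarrow> d x x = 0"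
  by (simp add: dist_zero_iff)

text \<open>The diagonal is the complement of the superlevel set of \<open>d\<close> above 0, which
  is open by lower semicontinuity.\<close>

lemma Hausdorff: "Hausdorff_space X"
proof -
  have "openin (prod_topology X X)
      {p \<in> topspace (prod_topology X X). 0 < (case p of (x, y) \<Rightarrow> d x y)}" (is "openin _ ?U")
    using lsc unfolding lower_semicontinuous_map_def by blast
  moreover have "(\<lambda>x. (x, x)) ` topspace X = topspace (prod_topology X X) - ?U"
    by (auto simp: zero_less_iff_neq_zero dist_zero_iff image_iff)
  ultimately show ?thesis
    unfolding Hausdorff_space_closedin_diagonal
    by (simp only: closedin_diff[OF closedin_topspace])
qed

lemma normal: "normal_space X"
  using compact Hausdorff compact_Hausdorff_or_regular_imp_normal_space by blast

text \<open>The neighbourhood is the second projection of the pairs in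
  \<open>F \<times> topspace X\<close> at distance at most \<open>r\<close>. These pairs form a
  closed set, and projecting along a compact factor is a closed map.\<close>

lemma closedin_neighbourhood:
  assumes "closedin X F"
  shows "closedin X {z \<in> topspace X. \<exists>x\<in>F. d x z \<le> r}"
proof -
  have F: "F \<subseteq> topspace X"
    using assms closedin_subset by blast
  have "openin (prod_topology X X)
      {p \<in> topspace (prod_topology X X). r < (case p of (x, y) \<Rightarrow> d x y)}" (is "openin _ ?U")
    using lsc unfolding lower_semicontinuous_map_def by blast
  then have "closedin (prod_topology X X) (topspace (prod_topology X X) - ?U)"
    by blast
  then have "closedin (prod_topology X X) (F \<times> topspace X \<inter> (topspace (prod_topology X X) - ?U))"
    using assms by (intro closedin_Int) (auto simp: closedin_prod_Times_iff)
  then have "closedin X (snd ` (F \<times> topspace X \<inter> (topspace (prod_topology X X) - ?U)))"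
    using closed_map_snd[OF compact] unfolding closed_map_def by blast
  moreover have "snd ` (F \<times> topspace X \<inter> (topspace (prod_topology X X) - ?U)) =
      {z \<in> topspace X. \<exists>x\<in>F. d x z \<le> r}"
    using F by (force simp: image_iff not_less)
  ultimately show ?thesis by simp
qed

text \<open>Compactness makes the refinement condition on the metric topology automatic.\<close>

lemma ext_metric_open_if_openin:
  assumes "openin X U"
  shows "ext_metric_open (topspace X) d U"
  unfolding ext_metric_open_def
proof (intro conjI ballI)
  show sub: "U \<subseteq> topspace X"
    using assms openin_subset by blast
  fix x assume x: "x \<in> U"
  then have xt: "x \<in> topspace X" using sub by blast
  \<comment> \<open>The open sets \<open>W n\<close> cover the compact complement of
    \<open>U\<close>, since the distance from \<open>x\<close> is positive there; a finite subcover
    yields a uniform lower bound on this distance.\<close>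
  define W where "W n = {y \<in> topspace X. ennreal (inverse (real (Suc n))) < d x y}" for n
  have "compactin X (topspace X - U)"
    using compact assms closedin_compact_space by blast
  moreover have "openin X V" if "V \<in> range W" for V
    using that openin_lower_semicontinuous_section[OF lsc xt] by (auto simp: W_def)
  moreover have "topspace X - U \<subseteq> \<Union>(range W)"
  proof
    fix y assume y: "y \<in> topspace X - U"
    then have "d x y > 0"
      using dist_zero_iff[OF xt, of y] x by (auto simp: zero_less_iff_neq_zero)
    then obtain e where e: "0 < e" "e < d x y" using dense by blast
    then obtain c where c: "e = ennreal c" "0 < c"
      by (cases e) (auto simp: ennreal_less_zero_iff)
    obtain n where "inverse (real (Suc n)) < c"
      using reals_Archimedean[OF c(2)] by blast
    then have "ennreal (inverse (real (Suc n))) < d x y"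
      using e c by (metis ennreal_leI less_imp_le order_le_less_trans)
    then show "y \<in> \<Union>(range W)"
      using y by (auto simp: W_def)
  qed
  ultimately obtain \<F> where "finite \<F>" "\<F> \<subseteq> range W" "topspace X - U \<subseteq> \<Union>\<F>"
    unfolding compactin_def by meson
  then obtain N where N: "finite N" "topspace X - U \<subseteq> \<Union>(W ` N)"
    using finite_subset_image[of \<F> W UNIV] by metis
  obtain k where k: "\<forall>n\<in>N. n \<le> k"
    using N(1) finite_nat_set_iff_bounded_le by blast
  show "\<exists>\<epsilon>>0. \<forall>y\<in>topspace X. d x y < \<epsilon> \<longrightarrow> y \<in> U"
  proof (intro exI[of _ "ennreal (inverse (real (Suc k)))"] conjI ballI impI)
    fix y assume y: "y \<in> topspace X" "d x y < ennreal (inverse (real (Suc k)))"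
    show "y \<in> U"
    proof (rule ccontr)
      assume "y \<notin> U"
      then obtain n where "n \<in> N" "y \<in> W n" using N y by blast
      then have "n \<le> k" "ennreal (inverse (real (Suc n))) < d x y" using k by (auto simp: W_def)
      moreover from this have "ennreal (inverse (real (Suc k))) \<le> ennreal (inverse (real (Suc n)))"
        by (intro ennreal_leI) (simp add: field_simps)
      ultimately show False using y(2) by (meson less_le_trans less_asym)
    qed
  qed simp
qed

section \<open>A Lipschitz version of Urysohn's lemma\<close>

text \<open>The inequality is strict so that it contradicts the non-strict bounds defining closed
  neighbourhoods. For every \<open>r\<close> it forces \<open>C\<close> and \<open>D\<close> to have
  no common point of the space, where the distance would be 0.\<close>

definition apart :: "'a set \<Rightarrow> 'a set \<Rightarrow> real \<Rightarrow> bool" where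
  "apart C D r \<longleftrightarrow> (\<forall>x\<in>C. \<forall>y\<in>D. ennreal r < d x y)"

text \<open>Inserts one level \<open>p\<close> between finitely many lower levels \<open>s\<close>
  and upper levels \<open>t\<close>. The set \<open>V\<close> has to contain the closed
  \<open>(p - s)\<close>-neighbourhoods of the lower sets, and its closure has to miss the closed
  \<open>(t - p)\<close>-neighbourhoods of the upper ones. A common point would give
  \<open>d x y \<le> t - s\<close> by the triangle inequality, so normality separates the two finite
  unions.\<close>

lemma apart_insert:
  assumes "finite L" "finite U"
    and L: "\<And>C s. (C, s) \<in> L \<Longrightarrow> closedin X C \<and> s < p"
    and U: "\<And>D t. (D, t) \<in> U \<Longrightarrow> closedin X D \<and> p < t"
    and LU: "\<And>C s D t. (C, s) \<in> L \<Longrightarrow> (D, t) \<in> U \<Longrightarrow> apart C D (t - s)"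
  obtains V where "openin X V"
    and "\<And>C s. (C, s) \<in> L \<Longrightarrow> apart C (topspace X - V) (p - s)"
    and "\<And>D t. (D, t) \<in> U \<Longrightarrow> apart (X closure_of V) D (t - p)"
proof -
  define K where "K = (\<Union>(C, s)\<in>L. {z \<in> topspace X. \<exists>x\<in>C. d x z \<le> ennreal (p - s)})"
  define M where "M = (\<Union>(D, t)\<in>U. {z \<in> topspace X. \<exists>y\<in>D. d y z \<le> ennreal (t - p)})"
  have "closedin X K" "closedin X M"
    unfolding K_def M_def using assms(1,2) L U
    by (auto intro!: closedin_Union closedin_neighbourhood simp: image_iff)
  moreover have "disjnt K M"
  proof (rule ccontr)
    assume "\<not> disjnt K M"
    then obtain z where K: "z \<in> K" and M: "z \<in> M"
      by (auto simp: disjnt_iff)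
    from K obtain C s x where z: "z \<in> topspace X"
      and C: "(C, s) \<in> L" "x \<in> C" "d x z \<le> ennreal (p - s)"
      unfolding K_def by auto
    from M obtain D t y where D: "(D, t) \<in> U" "y \<in> D" "d y z \<le> ennreal (t - p)"
      unfolding M_def by auto
    have xy: "x \<in> topspace X" "y \<in> topspace X"
      using L[OF C(1)] U[OF D(1)] C(2) D(2) by (auto dest: closedin_subset)
    have "d x y \<le> d x z + d y z"
      using dist_triangle[OF xy(1) z xy(2)] dist_commute[OF z xy(2)] by simp
    also have "\<dots> \<le> ennreal (p - s) + ennreal (t - p)"
      using C(3) D(3) by (rule add_mono)
    also have "\<dots> = ennreal (t - s)"
      using L[OF C(1)] U[OF D(1)] by (simp flip: ennreal_plus)
    finally show False
      using LU[OF C(1) D(1)] C(2) D(2) by (auto simp: apart_def not_le[symmetric])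
  qed
  ultimately obtain V where V: "openin X V" "K \<subseteq> V" "disjnt M (X closure_of V)"
    using normal unfolding normal_space by meson
  show thesis
  proof (rule that)
    show "openin X V" by (fact V(1))
  next
    fix C s assume C: "(C, s) \<in> L"
    show "apart C (topspace X - V) (p - s)"
      unfolding apart_def
    proof (intro ballI, rule ccontr)
      fix x z assume "x \<in> C" "z \<in> topspace X - V" "\<not> ennreal (p - s) < d x z"
      then have "z \<in> K" unfolding K_def by (intro UN_I[OF C]) (auto simp: not_less)
      then show False using V \<open>z \<in> topspace X - V\<close> by blast
    qed
  next
    fix D t assume D: "(D, t) \<in> U"
    show "apart (X closure_of V) D (t - p)"
      unfolding apart_def
    proof (intro ballI, rule ccontr)
      fix z y assume z: "z \<in> X closure_of V" "y \<in> D" "\<not> ennreal (t - p) < d z y"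
      then have "z \<in> topspace X" "y \<in> topspace X"
        using U[OF D] by (auto simp: in_closure_of dest: closedin_subset)
      then have "z \<in> M"
        using z(2,3) dist_commute[of z y] unfolding M_def by (intro UN_I[OF D]) (auto simp: not_less)
      then show False using V z by (auto simp: disjnt_iff)
    qed
  qed
qed

text \<open>The levels come in an arbitrary order, so \<open>U n\<close> is chosen recursively:
  \<open>apart_insert\<close> fits it between the finitely many earlier sets of smaller and of
  larger level.\<close>

lemma Urysohn_chain:
  fixes q :: "nat \<Rightarrow> real"
  assumes F: "closedin X F" and G: "closedin X G" and FG: "apart F G r"
    and q: "\<And>n. 0 < q n \<and> q n < r"
  obtains U where "\<And>n. openin X (U n)"
    and "\<And>n. apart F (topspace X - U n) (q n)"
    and "\<And>n. apart (X closure_of (U n)) G (r - q n)"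
    and "\<And>m n. q m < q n \<Longrightarrow> apart (X closure_of (U m)) (topspace X - U n) (q n - q m)"
proof -
  \<comment> \<open>\<open>F\<close> serves as the closed set at level 0, and \<open>G\<close> below
    as the complement at level \<open>r\<close>.\<close>
  define L where "L U n = insert (F, 0) ((\<lambda>m. (X closure_of (U m), q m)) ` {m. m < n \<and> q m < q n})"
    for U and n :: nat
  define H where "H U n = insert (G, r) ((\<lambda>m. (topspace X - U m, q m)) ` {m. m < n \<and> q n < q m})"
    for U and n :: nat
  define P where "P U n V \<longleftrightarrow> openin X V \<and>
      (\<forall>(C, s)\<in>L U n. apart C (topspace X - V) (q n - s)) \<and>
      (\<forall>(D, t)\<in>H U n. apart (X closure_of V) D (t - q n))" for U n V
  have "\<exists>U. \<forall>n. P U n (U n)"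
  proof (rule dependent_wellorder_choice)
    \<comment> \<open>Recursive choice requires that \<open>P U n\<close> depend on \<open>U\<close>
      only below \<open>n\<close>, which holds because \<open>L\<close> and \<open>H\<close> range
      over \<open>m < n\<close>.\<close>
    fix V :: "'a set" and U U' :: "nat \<Rightarrow> 'a set" and n :: nat
    assume "\<And>m. m < n \<Longrightarrow> U m = U' m"
    then have "L U n = L U' n" "H U n = H U' n"
      unfolding L_def H_def by (auto simp: image_iff)
    then show "P U n V = P U' n V" unfolding P_def by simp
  next
    fix n :: nat and U :: "nat \<Rightarrow> 'a set"
    assume IH: "\<And>m. m < n \<Longrightarrow> P U m (U m)"
    \<comment> \<open>Of the two sets, the one chosen later was required to keep the gap: from below
      if this is \<open>U m\<close>, from above if it is \<open>U k\<close>.\<close>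
    have UU: "apart (X closure_of (U k)) (topspace X - U m) (q m - q k)"
      if "k < n" "m < n" "q k < q m" for k m
    proof (cases "k < m")
      case True
      then show ?thesis using IH[OF that(2)] that unfolding P_def L_def by auto
    next
      case False
      then have "m < k" using that by (cases "k = m") auto
      then show ?thesis using IH[OF that(1)] that unfolding P_def H_def by auto
    qed
    have FU: "apart F (topspace X - U m) (q m)" and UG: "apart (X closure_of (U m)) G (r - q m)"
      if "m < n" for m
      using IH[OF that] unfolding P_def L_def H_def by auto
    have "finite (L U n)" "finite (H U n)"
      unfolding L_def H_def by auto
    moreover have "closedin X C \<and> s < q n" if "(C, s) \<in> L U n" for C s
      using that F q unfolding L_def by auto
    moreover have "closedin X D \<and> q n < t" if "(D, t) \<in> H U n" for D t
      using that G q IH unfolding H_def P_def by auto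
    moreover have "apart C D (t - s)" if "(C, s) \<in> L U n" "(D, t) \<in> H U n" for C s D t
      using that FG UU FU UG unfolding L_def H_def by auto
    ultimately obtain V where "openin X V"
      "\<And>C s. (C, s) \<in> L U n \<Longrightarrow> apart C (topspace X - V) (q n - s)"
      "\<And>D t. (D, t) \<in> H U n \<Longrightarrow> apart (X closure_of V) D (t - q n)"
      using apart_insert[of "L U n" "H U n" "q n"] by metis
    then show "\<exists>V. P U n V" unfolding P_def by auto
  qed
  then obtain U where U: "\<And>n. P U n (U n)" by blast
  show thesis
  proof (rule that)
    show "openin X (U n)" "apart F (topspace X - U n) (q n)"
      "apart (X closure_of (U n)) G (r - q n)" for n
      using U[of n] unfolding P_def L_def H_def by auto
  next
    fix m n assume mn: "q m < q n"
    show "apart (X closure_of (U m)) (topspace X - U n) (q n - q m)"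
    proof (cases "m < n")
      case True
      then show ?thesis using U[of n] mn unfolding P_def L_def by auto
    next
      case False
      then have "n < m" using mn by (cases "m = n") auto
      then show ?thesis using U[of m] mn unfolding P_def H_def by auto
    qed
  qed
qed

text \<open>The gaps in the chain make \<open>f\<close> 1-Lipschitz: if \<open>f y - f x\<close>
  exceeded \<open>d x y\<close>, two levels differing by more than \<open>d x y\<close> would fit
  between \<open>f x\<close> and \<open>f y\<close>, and the corresponding sets would be too far
  apart.\<close>

lemma Lipschitz_Urysohn:
  assumes F: "closedin X F" and G: "closedin X G" and r: "0 < r"
    and FG: "\<And>x y. x \<in> F \<Longrightarrow> y \<in> G \<Longrightarrow> ennreal r < d x y"
  obtains f :: "'a \<Rightarrow> real" where "continuous_map X euclideanreal f"
    and "\<And>x. x \<in> F \<Longrightarrow> f x = 0" and "\<And>x. x \<in> G \<Longrightarrow> f x = r"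
    and "\<And>x y. x \<in> topspace X \<Longrightarrow> y \<in> topspace X \<Longrightarrow> ennreal \<bar>f x - f y\<bar> \<le> d x y"
proof -
  \<comment> \<open>An enumeration of the rational levels strictly between 0 and \<open>r\<close>;
    the end levels belong to \<open>F\<close> and \<open>G\<close>.\<close>
  define q where "q = from_nat_into (\<rat> \<inter> {0<..<r})"
  have dense: "\<exists>n. a < q n \<and> q n < b" if "a < b" "0 \<le> a" "b \<le> r" for a b
  proof -
    obtain c where c: "c \<in> \<rat>" "a < c" "c < b"
      using Rats_dense_in_real[OF \<open>a < b\<close>] by blast
    then have "c \<in> \<rat> \<inter> {0<..<r}" using that by auto
    then show ?thesis
      using from_nat_into_surj[of "\<rat> \<inter> {0<..<r}" c] countable_rat c unfolding q_def by auto
  qed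
  have "\<rat> \<inter> {0<..<r} \<noteq> {}"
    using Rats_dense_in_real[OF r] by auto
  then have q: "0 < q n \<and> q n < r" for n
    using from_nat_into[of "\<rat> \<inter> {0<..<r}" n] unfolding q_def by auto
  have "apart F G r" using FG unfolding apart_def by blast
  then obtain U where U: "\<And>n. openin X (U n)"
    and FU: "\<And>n. apart F (topspace X - U n) (q n)"
    and UG: "\<And>n. apart (X closure_of (U n)) G (r - q n)"
    and UU: "\<And>m n. q m < q n \<Longrightarrow> apart (X closure_of (U m)) (topspace X - U n) (q n - q m)"
    using Urysohn_chain[of F G r q, OF F G _ q] by blast
  have cl: "U n \<subseteq> X closure_of (U n)" and Ut: "U n \<subseteq> topspace X" for n
    using U[of n] by (auto simp: closure_of_subset openin_subset)
  \<comment> \<open>A positive gap implies inclusion: a point of the closure outside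
    \<open>U n\<close> would have positive distance from itself.\<close>
  have Ucl: "X closure_of (U m) \<subseteq> U n" if "q m < q n" for m n
  proof
    fix x assume x: "x \<in> X closure_of (U m)"
    then have xt: "x \<in> topspace X" by (simp add: in_closure_of)
    then have "d x x = 0" by simp
    then show "x \<in> U n" using UU[OF that] x xt unfolding apart_def by force
  qed
  \<comment> \<open>The inserted \<open>r\<close> is the value at points lying in no
    \<open>U n\<close>, and keeps the set nonempty.\<close>
  define f where "f x = Inf (insert r (q ` {n. x \<in> U n}))" for x
  have bdd: "bdd_below (insert r (q ` {n. x \<in> U n}))" for x
    using q by (intro bdd_belowI[of _ 0]) (auto simp: less_imp_le r)
  have f_le: "f x \<le> q n" if "x \<in> U n" for x n
    unfolding f_def using that by (intro cInf_lower bdd) auto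
  have f_le_r: "f x \<le> r" for x
    unfolding f_def by (intro cInf_lower bdd) auto
  have f_ge: "a \<le> f x" if "a \<le> r" "\<And>n. x \<in> U n \<Longrightarrow> a \<le> q n" for x a
    unfolding f_def using that by (intro cInf_greatest) auto
  have f_less: "\<exists>n. x \<in> U n \<and> q n < a" if "f x < a" "a \<le> r" for x a
    using f_ge[of a x] that by (meson not_le)
  have f_nonneg: "0 \<le> f x" for x
    using q r by (intro f_ge) (auto simp: less_imp_le)
  show thesis
  proof (rule that)
    show "continuous_map X euclideanreal f"
      unfolding continuous_map_upper_lower_semicontinuous_lt
    proof (intro conjI allI)
      fix a
      show "openin X {x \<in> topspace X. f x < a}"
      proof (cases "a \<le> r")
        case True
        have "{x \<in> topspace X. f x < a} = \<Union>(U ` {n. q n < a})"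
        proof (intro subset_antisym subsetI)
          fix x assume "x \<in> \<Union>(U ` {n. q n < a})"
          then obtain n where "x \<in> U n" "q n < a" by blast
          then show "x \<in> {x \<in> topspace X. f x < a}"
            using f_le[of x n] Ut by auto
        qed (use f_less True in blast)
        then show ?thesis using U by (auto intro: openin_Union)
      next
        case False
        then have "f x < a" for x
          using f_le_r[of x] by linarith
        then have "{x \<in> topspace X. f x < a} = topspace X"
          by blast
        then show ?thesis by simp
      qed
      show "openin X {x \<in> topspace X. f x > a}"
      proof (cases "0 \<le> a")
        case True
        have "{x \<in> topspace X. f x > a} = \<Union>((\<lambda>n. topspace X - X closure_of (U n)) ` {n. a < q n})"
        proof (intro subset_antisym subsetI)
          fix x assume x: "x \<in> {x \<in> topspace X. f x > a}"
          then obtain n where n: "a < q n" "q n < f x"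
            using dense[of a "f x"] True f_le_r by auto
          \<comment> \<open>A second level is needed: \<open>f x > q m\<close> only excludes
            \<open>x\<close> from \<open>U m\<close>, and \<open>U m\<close> contains the closure of
            \<open>U n\<close>.\<close>
          then obtain m where m: "q n < q m" "q m < f x"
            using dense[of "q n" "f x"] q f_le_r by (meson less_imp_le)
          then have "x \<notin> U m" using f_le[of x m] by auto
          then have "x \<notin> X closure_of (U n)" using Ucl[OF m(1)] by blast
          then show "x \<in> \<Union>((\<lambda>n. topspace X - X closure_of (U n)) ` {n. a < q n})"
            using x n by blast
        next
          fix x assume "x \<in> \<Union>((\<lambda>n. topspace X - X closure_of (U n)) ` {n. a < q n})"
          then obtain n where n: "a < q n" "x \<in> topspace X" "x \<notin> X closure_of (U n)" by blast
          have "q n \<le> f x"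
          proof (rule f_ge)
            fix k assume "x \<in> U k"
            show "q n \<le> q k"
            proof (rule ccontr)
              assume "\<not> q n \<le> q k"
              then have "U k \<subseteq> U n" using Ucl[of k n] cl by fastforce
              then show False using \<open>x \<in> U k\<close> cl n by blast
            qed
          qed (use q less_imp_le in blast)
          then show "x \<in> {x \<in> topspace X. f x > a}" using n by auto
        qed
        then show ?thesis
          by (simp only:) (rule openin_Union, auto)
      next
        case False
        then have "f x > a" for x
          using f_nonneg[of x] by linarith
        then have "{x \<in> topspace X. f x > a} = topspace X"
          by blast
        then show ?thesis by simp
      qed
    qed
  next
    fix x assume x: "x \<in> F"
    then have xt: "x \<in> topspace X" using F closedin_subset by blast
    then have "d x x = 0" by simp
    then have xU: "x \<in> U n" for n using FU[of n] x xt unfolding apart_def by force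
    have "\<not> 0 < f x"
    proof
      assume "0 < f x"
      then obtain n where "q n < f x" using dense[of 0 "f x"] f_le_r by auto
      then show False using f_le[OF xU, of n] by simp
    qed
    then show "f x = 0" using f_nonneg[of x] by simp
  next
    fix x assume x: "x \<in> G"
    then have xt: "x \<in> topspace X" using G closedin_subset by blast
    then have "d x x = 0" by simp
    then have "x \<notin> U n" for n using UG[of n] x cl unfolding apart_def by force
    then show "f x = r" using f_ge[of r x] f_le_r[of x] by force
  next
    have key: "ennreal (f y - f x) \<le> d x y"
      if xy: "x \<in> topspace X" "y \<in> topspace X" for x y
    proof (rule ccontr)
      assume "\<not> ennreal (f y - f x) \<le> d x y"
      then have less: "d x y < ennreal (f y - f x)" by simp
      then obtain c where c: "d x y = ennreal c" "0 \<le> c"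
        by (cases "d x y") auto
      then have c_less: "c < f y - f x" using less by (simp add: ennreal_less_iff)
      \<comment> \<open>The levels satisfy \<open>q m - q n > c\<close>, while \<open>x\<close> lies
        in \<open>U n\<close> and \<open>y\<close> outside \<open>U m\<close>, so the chain forces a
        distance above \<open>c\<close>.\<close>
      then obtain n where n: "x \<in> U n" "q n < f y - c"
        using f_less[of x "f y - c"] f_le_r[of y] c by auto
      then obtain m where m: "q n + c < q m" "q m < f y"
        using dense[of "q n + c" "f y"] q[of n] f_le_r[of y] c by force
      have "y \<notin> U m" using f_le[of y m] m by auto
      then have "ennreal (q m - q n) < d x y"
        using UU[of n m] m c n cl xy unfolding apart_def by force
      then show False using c m by (simp add: ennreal_less_iff)
    qed
    fix x y assume "x \<in> topspace X" "y \<in> topspace X"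
    then show "ennreal \<bar>f x - f y\<bar> \<le> d x y"
      using key[of x y] key[of y x] dist_commute[of x y] by (auto simp: abs_if)
  qed
qed

section \<open>The metric and the L(1)-set of its Lipschitz functions\<close>

text \<open>For each real \<open>r\<close> with \<open>0 < r < d x y\<close>, the Urysohn function
  for the two singletons takes values differing by exactly \<open>r\<close>. Approaching
  \<open>d x y\<close> strictly from below also covers infinite distance.\<close>

lemma dist_eq_SUP:
  assumes xy: "x \<in> topspace X" "y \<in> topspace X"
  shows "d x y = (SUP f\<in>C_L1 X d. ennreal (cmod (f x - f y)))"
proof (rule antisym)
  show "(SUP f\<in>C_L1 X d. ennreal (cmod (f x - f y))) \<le> d x y"
    using xy by (auto simp: C_L1_def one_Lipschitz_on_def intro: SUP_least)
  show "d x y \<le> (SUP f\<in>C_L1 X d. ennreal (cmod (f x - f y)))"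
  proof (rule dense_le)
    fix e assume e: "e < d x y"
    show "e \<le> (SUP f\<in>C_L1 X d. ennreal (cmod (f x - f y)))"
    proof (cases "e = 0")
      case False
      with e obtain r where r: "e = ennreal r" "0 < r"
        by (cases e) (auto simp: zero_less_iff_neq_zero top.extremum_strict)
      have "closedin X {x}" "closedin X {y}"
        using xy Hausdorff by (auto simp: closedin_Hausdorff_singleton)
      then obtain f :: "'a \<Rightarrow> real" where f: "continuous_map X euclideanreal f" "f x = 0" "f y = r"
        "\<And>u v. u \<in> topspace X \<Longrightarrow> v \<in> topspace X \<Longrightarrow> ennreal \<bar>f u - f v\<bar> \<le> d u v"
        using Lipschitz_Urysohn[of "{x}" "{y}" r] r e by (metis singletonD singletonI)
      define g where "g = (\<lambda>u\<in>topspace X. complex_of_real (f u))"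
      have "continuous_map X euclidean (\<lambda>u. complex_of_real (f u))"
        using f(1) by (rule continuous_map_euclidean_compose) (intro continuous_intros)
      then have "continuous_map X euclidean g"
        by (rule continuous_map_eq) (simp add: g_def)
      then have "g \<in> C_L1 X d"
        using f(4) by (auto simp: C_L1_def Cfun_def one_Lipschitz_on_def g_def simp flip: of_real_diff)
      moreover have "cmod (g x - g y) = r"
        using f r xy by (simp add: g_def)
      ultimately show ?thesis
        unfolding r(1) by (metis (no_types, lifting) SUP_upper)
    qed simp
  qed
qed

lemma C_L1_separates:
  assumes "x \<in> topspace X" "y \<in> topspace X" "x \<noteq> y"
  shows "\<exists>f\<in>C_L1 X d. f x \<noteq> f y"
proof (rule ccontr)
  assume "\<not> ?thesis"
  then have "(SUP f\<in>C_L1 X d. ennreal (cmod (f x - f y))) \<le> 0"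
    by (intro SUP_least) auto
  then show False
    using assms dist_eq_SUP[of x y] dist_zero_iff[of x y] by simp
qed

text \<open>The Lipschitz condition concerns two points at a time, so its failure at a pair persists
  under small changes of the two values; separation of points comes from the supremum
  formula.\<close>

lemma L1_set_C_L1: "L1_set X (C_L1 X d)"
proof -
  have mem: "restrict f (topspace X) \<in> C_L1 X d"
    if "continuous_map X euclidean f"
      "\<And>x y. x \<in> topspace X \<Longrightarrow> y \<in> topspace X \<Longrightarrow> ennreal (cmod (f x - f y)) \<le> d x y" for f
  proof -
    have "continuous_map X euclidean (restrict f (topspace X))"
      using that(1) by (rule continuous_map_eq) simp
    then show ?thesis
      using that(2) by (auto simp: C_L1_def Cfun_def one_Lipschitz_on_def)
  qed
  have cont: "continuous_map X euclidean f" if "f \<in> C_L1 X d" for f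
    using that by (simp add: C_L1_def Cfun_def)
  have lip: "ennreal (cmod (f x - f y)) \<le> d x y"
    if "f \<in> C_L1 X d" "x \<in> topspace X" "y \<in> topspace X" for f x y
    using that by (simp add: C_L1_def one_Lipschitz_on_def)
  show ?thesis
    unfolding L1_set_def
  proof (intro conjI ballI allI impI)
    show "C_L1 X d \<subseteq> Cfun X"
      by (auto simp: C_L1_def)
  next
    fix f g and t :: real
    assume f: "f \<in> C_L1 X d" and g: "g \<in> C_L1 X d" and t: "0 \<le> t \<and> t \<le> 1"
    show "(\<lambda>x\<in>topspace X. of_real (1 - t) * f x + of_real t * g x) \<in> C_L1 X d"
    proof (rule mem)
      show "continuous_map X euclidean (\<lambda>x. of_real (1 - t) * f x + of_real t * g x)"
        using cont[OF f] cont[OF g]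
        by (intro continuous_map_add continuous_map_euclidean_compose[where h = "(*) _"] continuous_intros)
      fix x y assume xy: "x \<in> topspace X" "y \<in> topspace X"
      have "of_real (1 - t) * f x + of_real t * g x - (of_real (1 - t) * f y + of_real t * g y) =
          of_real (1 - t) * (f x - f y) + of_real t * (g x - g y)"
        by (simp only: algebra_simps)
      also have "cmod \<dots> \<le> (1 - t) * cmod (f x - f y) + t * cmod (g x - g y)"
        using t by (intro norm_triangle_le) (simp only: norm_mult norm_of_real, simp)
      \<comment> \<open>Passing to a maximum of reals avoids convex combinations in
        \<open>ennreal\<close>, where \<open>d x y\<close> may be infinite.\<close>
      also have "\<dots> \<le> max (cmod (f x - f y)) (cmod (g x - g y))"
        using t by (intro convex_bound_le) auto
      finally have "ennreal (cmod (of_real (1 - t) * f x + of_real t * g x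
          - (of_real (1 - t) * f y + of_real t * g y)))
          \<le> ennreal (max (cmod (f x - f y)) (cmod (g x - g y)))"
        by (rule ennreal_leI)
      also have "\<dots> \<le> d x y"
        using lip[OF f xy] lip[OF g xy] by (simp add: max_def)
      finally show "ennreal (cmod (of_real (1 - t) * f x + of_real t * g x
          - (of_real (1 - t) * f y + of_real t * g y))) \<le> d x y" .
    qed
  next
    fix f and \<alpha> :: complex
    assume f: "f \<in> C_L1 X d" and \<alpha>: "cmod \<alpha> \<le> 1"
    show "(\<lambda>x\<in>topspace X. \<alpha> * f x) \<in> C_L1 X d"
    proof (rule mem)
      show "continuous_map X euclidean (\<lambda>x. \<alpha> * f x)"
        using cont[OF f] by (rule continuous_map_euclidean_compose) (intro continuous_intros)
      fix x y assume xy: "x \<in> topspace X" "y \<in> topspace X"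
      have "cmod (\<alpha> * f x - \<alpha> * f y) \<le> cmod (f x - f y)"
        using \<alpha> by (simp add: norm_mult mult_left_le_one_le flip: right_diff_distrib)
      then show "ennreal (cmod (\<alpha> * f x - \<alpha> * f y)) \<le> d x y"
        using lip[OF f xy] ennreal_leI order_trans by blast
    qed
  next
    fix f assume f: "f \<in> C_L1 X d"
    show "(\<lambda>x\<in>topspace X. complex_of_real (cmod (f x))) \<in> C_L1 X d"
    proof (rule mem)
      show "continuous_map X euclidean (\<lambda>x. complex_of_real (cmod (f x)))"
        using cont[OF f]
        by (rule continuous_map_euclidean_compose[where h = "\<lambda>z. complex_of_real (cmod z)"])
          (intro continuous_intros)
      fix x y assume xy: "x \<in> topspace X" "y \<in> topspace X"
      have "cmod (complex_of_real (cmod (f x)) - complex_of_real (cmod (f y))) \<le> cmod (f x - f y)"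
        by (simp add: norm_triangle_ineq3 flip: of_real_diff)
      then show "ennreal (cmod (complex_of_real (cmod (f x)) - complex_of_real (cmod (f y)))) \<le> d x y"
        using lip[OF f xy] ennreal_leI order_trans by blast
    qed
  next
    fix x y assume "x \<in> topspace X" "y \<in> topspace X" "x \<noteq> y"
    then show "\<exists>f\<in>C_L1 X d. f x \<noteq> f y" by (rule C_L1_separates)
  next
    fix c :: complex
    show "(\<lambda>x\<in>topspace X. c) \<in> C_L1 X d"
      by (rule mem) auto
  next
    fix f assume "f \<in> Cfun X" "f \<notin> C_L1 X d"
    then obtain x y where xy: "x \<in> topspace X" "y \<in> topspace X"
      and less: "d x y < ennreal (cmod (f x - f y))"
      unfolding C_L1_def one_Lipschitz_on_def by (auto simp: not_le)
    then obtain c where c: "d x y = ennreal c" "0 \<le> c"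
      by (cases "d x y") auto
    then have c_less: "c < cmod (f x - f y)"
      using less by (simp add: ennreal_less_iff)
    show "\<exists>x\<in>topspace X. \<exists>y\<in>topspace X. \<exists>\<epsilon>::real. \<epsilon> > 0 \<and>
        (\<forall>g\<in>Cfun X. cmod (f x - g x) < \<epsilon> \<and> cmod (f y - g y) < \<epsilon> \<longrightarrow> g \<notin> C_L1 X d)"
    proof (rule bexI[OF _ xy(1)], rule bexI[OF _ xy(2)], intro exI conjI ballI impI)
      \<comment> \<open>Each of the two values may move by half the excess over
        \<open>c = d x y\<close>, so the values of \<open>g\<close> still differ by more than
        \<open>c\<close>.\<close>
      show "0 < (cmod (f x - f y) - c) / 2"
        using c_less by simp
      fix g
      assume near: "cmod (f x - g x) < (cmod (f x - f y) - c) / 2 \<and>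
          cmod (f y - g y) < (cmod (f x - f y) - c) / 2"
      have "f x - f y = (f x - g x) + (g x - g y) - (f y - g y)"
        by simp
      then have "cmod (f x - f y) \<le> cmod (f x - g x) + cmod (g x - g y) + cmod (f y - g y)"
        by (metis norm_triangle_ineq norm_triangle_le_diff add_right_mono)
      then have "c < cmod (g x - g y)"
        using near by (simp add: field_simps)
      then show "g \<notin> C_L1 X d"
        using lip[of g x y] xy c by auto
    qed
  qed
qed

end

lemma compact_topometric_if_topometric_space:
  assumes "compact_space X" "topometric_space X d"
  shows "compact_topometric X d"
  using assms by unfold_locales (auto simp: topometric_space_def)

section \<open>The metric of an L(1)-set\<close>

lemma L1_setD:
  assumes "L1_set X A"
  shows L1_set_subset_Cfun: "A \<subseteq> Cfun X"
    and L1_set_convex: "\<And>f g t. \<lbrakk>f \<in> A; g \<in> A; 0 \<le> t; t \<le> 1\<rbrakk> \<Longrightarrow>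
      (\<lambda>x\<in>topspace X. of_real (1 - t) * f x + of_real t * g x) \<in> A"
    and L1_set_scale: "\<And>f \<alpha>. \<lbrakk>f \<in> A; cmod \<alpha> \<le> 1\<rbrakk> \<Longrightarrow> (\<lambda>x\<in>topspace X. \<alpha> * f x) \<in> A"
    and L1_set_separates:
      "\<And>x y. \<lbrakk>x \<in> topspace X; y \<in> topspace X; x \<noteq> y\<rbrakk> \<Longrightarrow> \<exists>f\<in>A. f x \<noteq> f y"
    and L1_set_const: "\<And>c. (\<lambda>x\<in>topspace X. c) \<in> A"
    and L1_set_two_point_closed: "\<And>f. \<lbrakk>f \<in> Cfun X; f \<notin> A\<rbrakk> \<Longrightarrow>
      \<exists>x\<in>topspace X. \<exists>y\<in>topspace X. \<exists>\<epsilon>::real. \<epsilon> > 0 \<and>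
        (\<forall>g\<in>Cfun X. cmod (f x - g x) < \<epsilon> \<and> cmod (f y - g y) < \<epsilon> \<longrightarrow> g \<notin> A)"
proof -
  note parts = assms[unfolded L1_set_def]
  show "A \<subseteq> Cfun X" using parts by (rule conjunct1)
  note parts = parts[THEN conjunct2]
  show "(\<lambda>x\<in>topspace X. of_real (1 - t) * f x + of_real t * g x) \<in> A"
    if "f \<in> A" "g \<in> A" "0 \<le> t" "t \<le> 1" for f g t
    using parts[THEN conjunct1, rule_format, of f g t] that by simp
  note parts = parts[THEN conjunct2]
  show "(\<lambda>x\<in>topspace X. \<alpha> * f x) \<in> A" if "f \<in> A" "cmod \<alpha> \<le> 1" for f \<alpha>
    using parts[THEN conjunct1, rule_format, of f \<alpha>] that by simp
  note parts = parts[THEN conjunct2, THEN conjunct2]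
  show "\<exists>f\<in>A. f x \<noteq> f y" if "x \<in> topspace X" "y \<in> topspace X" "x \<noteq> y" for x y
    using parts[THEN conjunct1, rule_format, of x y] that by simp
  note parts = parts[THEN conjunct2]
  show "(\<lambda>x\<in>topspace X. c) \<in> A" for c
    using parts[THEN conjunct1] by (rule spec)
  note parts = parts[THEN conjunct2]
  show "\<exists>x\<in>topspace X. \<exists>y\<in>topspace X. \<exists>\<epsilon>::real. \<epsilon> > 0 \<and>
        (\<forall>g\<in>Cfun X. cmod (f x - g x) < \<epsilon> \<and> cmod (f y - g y) < \<epsilon> \<longrightarrow> g \<notin> A)"
    if "f \<in> Cfun X" "f \<notin> A" for f
    using bspec[OF parts that(1)] that(2) by (rule mp)
qed

text \<open>The strict bound on \<open>\<beta>\<close> leaves a positive convex weight for a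
  constant function, and that constant may be as large as \<open>c\<close> requires.\<close>

lemma L1_set_affine:
  assumes A: "L1_set X A" and h: "h \<in> A" and \<beta>: "cmod \<beta> < 1"
  shows "(\<lambda>x\<in>topspace X. \<beta> * h x + c) \<in> A"
proof (cases "\<beta> = 0")
  case True
  then show ?thesis using L1_set_const[OF A] by simp
next
  case False
  \<comment> \<open>a convex combination, with weight \<open>t\<close>, of a unimodular multiple of \<open>h\<close> and a constant\<close>
  define t where "t = 1 - cmod \<beta>"
  have t: "0 < t" "t < 1" "complex_of_real (1 - t) = of_real (cmod \<beta>)"
    using \<beta> False by (auto simp: t_def)
  have "cmod (\<beta> / of_real (cmod \<beta>)) \<le> 1"
    by (simp add: norm_divide)
  then have "(\<lambda>x\<in>topspace X. \<beta> / of_real (cmod \<beta>) * h x) \<in> A" (is "?u \<in> A")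
    by (rule L1_set_scale[OF A h])
  moreover have "(\<lambda>x\<in>topspace X. c / of_real t) \<in> A" (is "?v \<in> A")
    by (rule L1_set_const[OF A])
  ultimately have "(\<lambda>x\<in>topspace X. of_real (1 - t) * ?u x + of_real t * ?v x) \<in> A"
    by (rule L1_set_convex[OF A]) (use t in auto)
  also have "(\<lambda>x\<in>topspace X. of_real (1 - t) * ?u x + of_real t * ?v x) =
      (\<lambda>x\<in>topspace X. \<beta> * h x + c)"
    using t(1) False unfolding t(3) by (intro restrict_ext) simp
  finally show ?thesis .
qed

text \<open>The supremum need not be attained, so some \<open>h\<close> almost attaining
  \<open>cmod (a - b)\<close> is rescaled and translated. The result is exact at \<open>x\<close>
  and has a small error at \<open>y\<close>.\<close>

lemma L1_set_approx:
  assumes A: "L1_set X A" and xy: "x \<in> topspace X" "y \<in> topspace X" and "0 < \<epsilon>"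
    and le: "ennreal (cmod (a - b)) \<le> (SUP f\<in>A. ennreal (cmod (f x - f y)))"
  obtains g where "g \<in> A" "cmod (a - g x) < \<epsilon>" "cmod (b - g y) < \<epsilon>"
proof (cases "a = b")
  case True
  have "(\<lambda>x\<in>topspace X. a) \<in> A"
    by (rule L1_set_const[OF A])
  then show thesis
    using that True xy \<open>0 < \<epsilon>\<close> by force
next
  case False
  define \<delta> where "\<delta> = a - b"
  \<comment> \<open>The bound 1/2 keeps the factor \<open>1 - \<eta>\<close> positive; the other
    bound keeps the error \<open>\<eta> * cmod \<delta>\<close> at most
    \<open>\<epsilon> / 2\<close>.\<close>
  define \<eta> where "\<eta> = min (1/2) (\<epsilon> / (2 * cmod \<delta>))"
  have \<delta>: "0 < cmod \<delta>" using False by (simp add: \<delta>_def)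
  then have \<eta>: "0 < \<eta>" "\<eta> < 1" "\<eta> * cmod \<delta> < \<epsilon>"
    using \<open>0 < \<epsilon>\<close> by (auto simp: \<eta>_def min_def field_simps)
  have "ennreal ((1 - \<eta>) * cmod \<delta>) < ennreal (cmod \<delta>)"
    using \<delta> \<eta> by (intro ennreal_lessI) (auto simp: field_simps)
  also have "\<dots> \<le> (SUP f\<in>A. ennreal (cmod (f x - f y)))"
    using le by (simp add: \<delta>_def)
  finally obtain h where h: "h \<in> A" "ennreal ((1 - \<eta>) * cmod \<delta>) < ennreal (cmod (h x - h y))"
    by (auto simp: less_SUP_iff)
  then have less: "(1 - \<eta>) * cmod \<delta> < cmod (h x - h y)"
    using \<eta> by (simp add: ennreal_less_iff)
  then have pos: "0 < cmod (h x - h y)"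
    using \<eta> \<delta> by (smt (verit) mult_nonneg_nonneg)
  \<comment> \<open>Chosen so that \<open>\<beta> * h\<close> has difference
    \<open>(1 - \<eta>) * \<delta>\<close> between \<open>x\<close> and \<open>y\<close>; the choice
    of \<open>h\<close> gives \<open>cmod \<beta> < 1\<close>.\<close>
  define \<beta> where "\<beta> = of_real (1 - \<eta>) * \<delta> / (h x - h y)"
  have "cmod \<beta> = (1 - \<eta>) * cmod \<delta> / cmod (h x - h y)"
    unfolding \<beta>_def norm_mult norm_divide norm_of_real using \<eta> by simp
  then have "cmod \<beta> < 1"
    using less pos by simp
  define g where "g = (\<lambda>u\<in>topspace X. \<beta> * h u + (a - \<beta> * h x))"
  have "g \<in> A"
    unfolding g_def by (rule L1_set_affine[OF A h(1) \<open>cmod \<beta> < 1\<close>])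
  moreover have "g x = a"
    using xy by (simp add: g_def)
  moreover have "cmod (b - g y) < \<epsilon>"
  proof -
    have "\<beta> * (h x - h y) = of_real (1 - \<eta>) * \<delta>"
      using pos by (simp add: \<beta>_def)
    then have "b - g y = - (of_real \<eta> * \<delta>)"
      using xy by (simp add: g_def \<delta>_def algebra_simps)
    then show ?thesis
      using \<eta> by (simp add: norm_mult)
  qed
  ultimately show thesis
    using that \<open>0 < \<epsilon>\<close> by simp
qed

text \<open>Separation of points makes the supremum a metric, and continuity of the members makes it
  lower semicontinuous. A 1-Lipschitz function outside \<open>A\<close> would be isolated from
  \<open>A\<close> at some pair of points, against \<open>L1_set_approx\<close>.\<close>

lemma L1_set_imp_topometric:
  assumes X: "compact_space X" and A: "L1_set X A"
  defines "d \<equiv> \<lambda>x y. SUP f\<in>A. ennreal (cmod (f x - f y))"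
  shows "topometric_space X d" and "A = C_L1 X d"
proof -
  have sub: "A \<subseteq> Cfun X" using L1_set_subset_Cfun[OF A] .
  have le: "ennreal (cmod (f x - f y)) \<le> d x y" if "f \<in> A" for f x y
    unfolding d_def using that by (intro SUP_upper)
  have metric: "ext_metric_on (topspace X) d"
    unfolding ext_metric_on_def
  proof (intro conjI ballI)
    fix x y assume xy: "x \<in> topspace X" "y \<in> topspace X"
    show "d x y = 0 \<longleftrightarrow> x = y"
    proof
      assume 0: "d x y = 0"
      have "f x = f y" if "f \<in> A" for f
        using le[OF that, of x y] 0 by simp
      then show "x = y" using L1_set_separates[OF A xy] by blast
    next
      assume "x = y"
      then show "d x y = 0" unfolding d_def by (auto simp: SUP_eq_iff simp flip: bot_ennreal)
    qed
    show "d x y = d y x"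
      unfolding d_def by (simp add: norm_minus_commute)
  next
    fix x y z
    have "(SUP f\<in>A. ennreal (cmod (f x - f z))) \<le> d x y + d y z"
    proof (rule SUP_least)
      fix f assume f: "f \<in> A"
      have "cmod (f x - f z) \<le> cmod (f x - f y) + cmod (f y - f z)"
        using norm_triangle_ineq[of "f x - f y" "f y - f z"] by simp
      then have "ennreal (cmod (f x - f z)) \<le> ennreal (cmod (f x - f y)) + ennreal (cmod (f y - f z))"
        by (metis ennreal_leI ennreal_plus norm_ge_zero)
      also have "\<dots> \<le> d x y + d y z"
        using le[OF f] by (intro add_mono)
      finally show "ennreal (cmod (f x - f z)) \<le> d x y + d y z" .
    qed
    then show "d x z \<le> d x y + d y z" by (simp add: d_def)
  qed
  have lsc: "lower_semicontinuous_map (prod_topology X X) (\<lambda>(x, y). d x y)"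
    unfolding lower_semicontinuous_map_def
  proof
    fix r :: ennreal
    \<comment> \<open>A strict superlevel set of a supremum is the union of those of its members,
      each open by continuity.\<close>
    have "openin (prod_topology X X)
        {p \<in> topspace (prod_topology X X). r < ennreal (cmod (f (fst p) - f (snd p)))}"
      if "f \<in> A" for f
    proof -
      have "continuous_map X euclidean f"
        using that sub by (auto simp: Cfun_def)
      from continuous_map_compose[OF continuous_map_fst this]
        continuous_map_compose[OF continuous_map_snd this]
      have "continuous_map (prod_topology X X) euclidean (\<lambda>p. cmod (f (fst p) - f (snd p)))"
        by (intro continuous_intros) (simp_all only: comp_def)
      then have "continuous_map (prod_topology X X) euclidean
          (\<lambda>p. ennreal (cmod (f (fst p) - f (snd p))))"
        by (rule continuous_map_euclidean_compose) (intro continuous_on_ennreal continuous_intros)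
      then show ?thesis
        using openin_continuous_map_preimage[where U = "{r<..}"] by force
    qed
    then have "openin (prod_topology X X) (\<Union>f\<in>A.
        {p \<in> topspace (prod_topology X X). r < ennreal (cmod (f (fst p) - f (snd p)))})"
      by (intro openin_Union) auto
    also have "(\<Union>f\<in>A. {p \<in> topspace (prod_topology X X).
          r < ennreal (cmod (f (fst p) - f (snd p)))}) =
        {p \<in> topspace (prod_topology X X). r < (case p of (x, y) \<Rightarrow> d x y)}"
      by (auto simp: d_def less_SUP_iff)
    finally show "openin (prod_topology X X)
        {p \<in> topspace (prod_topology X X). r < (case p of (x, y) \<Rightarrow> d x y)}" .
  qed
  interpret compact_topometric X d
    by unfold_locales (fact X metric lsc)+
  show "topometric_space X d"
    unfolding topometric_space_def using metric lsc ext_metric_open_if_openin by blast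
  show "A = C_L1 X d"
  proof
    show "A \<subseteq> C_L1 X d"
      using sub le by (auto simp: C_L1_def one_Lipschitz_on_def)
    show "C_L1 X d \<subseteq> A"
    proof (rule subsetI, rule ccontr)
      fix f assume f: "f \<in> C_L1 X d" "f \<notin> A"
      then have "f \<in> Cfun X" by (simp add: C_L1_def)
      from L1_set_two_point_closed[OF A this f(2)] obtain x y \<epsilon> where xy: "x \<in> topspace X" "y \<in> topspace X" and \<epsilon>: "0 < \<epsilon>"
        and far: "\<forall>g\<in>Cfun X. cmod (f x - g x) < \<epsilon> \<and> cmod (f y - g y) < \<epsilon> \<longrightarrow> g \<notin> A"
        by blast
      have "ennreal (cmod (f x - f y)) \<le> (SUP g\<in>A. ennreal (cmod (g x - g y)))"
        using f(1) xy by (auto simp: C_L1_def one_Lipschitz_on_def d_def)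
      then obtain g where "g \<in> A" "cmod (f x - g x) < \<epsilon>" "cmod (f y - g y) < \<epsilon>"
        using L1_set_approx[OF A xy \<epsilon>] by blast
      then show False using far sub by blast
    qed
  qed
qed

theorem theorem3p4:
  fixes X :: "'a topology" and A :: "('a \<Rightarrow> complex) set"
  assumes "compact_space X" and "A \<subseteq> Cfun X"
  shows "(L1_set X A \<longleftrightarrow> (\<exists>d. topometric_space X d \<and> A = C_L1 X d)) \<and>
    (\<forall>d d'. topometric_space X d \<and> A = C_L1 X d \<and> topometric_space X d' \<and> A = C_L1 X d' \<longrightarrow>
       (\<forall>x\<in>topspace X. \<forall>y\<in>topspace X. d x y = d' x y)) \<and>
    (\<forall>d. topometric_space X d \<and> A = C_L1 X d \<longrightarrow>
       (\<forall>x\<in>topspace X. \<forall>y\<in>topspace X. d x y = (SUP f\<in>A. ennreal (cmod (f x - f y)))))"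
proof (intro conjI allI impI ballI)
  note compact_topometric = compact_topometric_if_topometric_space[OF assms(1)]
  show "L1_set X A \<longleftrightarrow> (\<exists>d. topometric_space X d \<and> A = C_L1 X d)"
  proof
    assume "L1_set X A"
    then show "\<exists>d. topometric_space X d \<and> A = C_L1 X d"
      using L1_set_imp_topometric[OF assms(1)] by (intro exI conjI)
  next
    assume "\<exists>d. topometric_space X d \<and> A = C_L1 X d"
    then obtain d where "topometric_space X d" "A = C_L1 X d"
      by (elim exE conjE)
    then show "L1_set X A"
      using compact_topometric.L1_set_C_L1[OF compact_topometric, of d] by simp
  qed
  have dist_eq: "d x y = (SUP f\<in>A. ennreal (cmod (f x - f y)))"
    if "topometric_space X d \<and> A = C_L1 X d" "x \<in> topspace X" "y \<in> topspace X" for d x y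
    using compact_topometric.dist_eq_SUP[OF compact_topometric, of d x y] that by simp
  fix d x y
  assume xy: "x \<in> topspace X" "y \<in> topspace X"
  show "d x y = (SUP f\<in>A. ennreal (cmod (f x - f y)))" if "topometric_space X d \<and> A = C_L1 X d"
    using that xy by (rule dist_eq)
  fix d'
  assume "topometric_space X d \<and> A = C_L1 X d \<and> topometric_space X d' \<and> A = C_L1 X d'"
  then have "topometric_space X d \<and> A = C_L1 X d" "topometric_space X d' \<and> A = C_L1 X d'"
    by - (elim conjE, intro conjI, assumption+)+
  \<comment> \<open>Both metrics equal the same supremum over \<open>A\<close>.\<close>
  from this[THEN dist_eq[OF _ xy]] show "d x y = d' x y"
    by (rule trans[OF _ sym])
qed

end
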